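(* Let $(V,\mathcal{E})$ be a finite $3$-uniform hypergraph with at least two vertices in which no four vertices induce exactly four hyperedges. Then $(V,\mathcal{E})$ has the De Bruijn–Erdős property: either it has at least $|V|$ distinct lines, or one of its lines equals $V$.
   Context: A $3$-uniform hypergraph $(V,\mathcal{E})$ has all hyperedges of size three. For distinct vertices $u,v$, the line $\overline{uv}$ is the set consisting of $u$, $v$, and all $w$ with $\{u,v,w\}\in\mathcal{E}$. Four distinct vertices induce four hyperedges if all four of their three-element subsets belong to $\mathcal{E}$. *)

theory Defs
  imports Main
begin

definition three_uniform_hypergraph :: "'a set \<Rightarrow> 'a set set \<Rightarrow> bool" where
  "three_uniform_hypergraph V E \<longleftrightarrow> (\<forall>e\<in>E. e \<subseteq> V \<and> card e = 3)"

text \<open>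
  Only meaningful for distinct \<open>u\<close> and \<open>v\<close>. In a 3-uniform hypergraph every \<open>w\<close> with
  \<open>{u, v, w} \<in> E\<close> is automatically a vertex different from \<open>u\<close> and \<open>v\<close>.
\<close>

definition line :: "'a set set \<Rightarrow> 'a \<Rightarrow> 'a \<Rightarrow> 'a set" where
  "line E u v = {u, v} \<union> {w. {u, v, w} \<in> E}"

definition lines :: "'a set \<Rightarrow> 'a set set \<Rightarrow> 'a set set" where
  "lines V E = {line E u v | u v. u \<in> V \<and> v \<in> V \<and> u \<noteq> v}"

definition induces_four_hyperedges :: "'a set set \<Rightarrow> 'a set \<Rightarrow> bool" where
  "induces_four_hyperedges E S \<longleftrightarrow> card S = 4 \<and> (\<forall>T. T \<subseteq> S \<and> card T = 3 \<longrightarrow> T \<in> E)"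

definition de_bruijn_erdos :: "'a set \<Rightarrow> 'a set set \<Rightarrow> bool" where
  "de_bruijn_erdos V E \<longleftrightarrow> card (lines V E) \<ge> card V \<or> V \<in> lines V E"

end

theory Submission
  imports Defs
begin

text \<open>
  Two disjoint pairs never generate the same line, since they would induce four hyperedges.
  Fix a vertex \<open>u\<close> and group the other vertices \<open>v\<close> by the line \<open>uv\<close>, with a representative
  \<open>r v\<close> in each group. Send a representative \<open>v\<close> to \<open>uv\<close> and any other \<open>v\<close> to the line through \<open>r v\<close>
  and \<open>v\<close>; both contain \<open>u\<close>. This is injective except for the set \<open>S\<close> of those \<open>v\<close> for which
  \<open>u\<close>, \<open>v\<close>, \<open>r v\<close> generate one and the same line, which is then \<open>{u, v, r v}\<close>. This gives
  \<open>|V| - 1 - |S|\<close> lines through \<open>u\<close>. For \<open>|S| \<ge> 2\<close>, the lines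
  joining different pairs \<open>{v, r v}\<close> miss \<open>u\<close>, and at least \<open>|S| + 1\<close> of them are distinct; for
  \<open>|S| \<le> 1\<close>, \<open>|S| + 1\<close> lines missing \<open>u\<close> arise from a vertex outside some line through \<open>u\<close>.
\<close>

section \<open>Symmetry of lines in their vertices\<close>

lemma line_commute: "line E u v = line E v u"
  by (auto simp: line_def insert_commute)

lemma line_endpoints: "u \<in> line E u v" "v \<in> line E u v"
  by (auto simp: line_def)

lemma in_line_iff: "w \<noteq> u \<Longrightarrow> w \<noteq> v \<Longrightarrow> w \<in> line E u v \<longleftrightarrow> {u, v, w} \<in> E"
  by (auto simp: line_def)

text \<open>Whether three distinct vertices form a hyperedge does not depend on their order. This is
  how lines that miss a given vertex are found.\<close>

lemma not_in_line_rotate: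
  assumes "w \<notin> line E u v"
  shows "v \<noteq> w \<Longrightarrow> u \<noteq> v \<Longrightarrow> u \<notin> line E v w"
  using assms by (auto simp: line_def insert_commute)

section \<open>Coinciding lines when no four vertices induce four hyperedges\<close>

locale K4_free_hypergraph =
  fixes V :: "'a set" and E :: "'a set set"
  assumes finite_V: "finite V"
    and uniform: "three_uniform_hypergraph V E"
    and K4_free: "\<not> (\<exists>S. S \<subseteq> V \<and> induces_four_hyperedges E S)"
begin

lemma no_four_triples:
  assumes dist: "distinct [a, b, c, d]"
    and E: "{a, b, c} \<in> E" "{a, b, d} \<in> E" "{a, c, d} \<in> E" "{b, c, d} \<in> E"
  shows False
proof -
  let ?S = "{a, b, c, d}"
  have "card ?S = 4" using dist by simp
  moreover have "T \<in> E" if T: "T \<subseteq> ?S" "card T = 3" for T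
  proof -
    have "card (?S - T) = 1"
      using T \<open>card ?S = 4\<close> by (simp add: card_Diff_subset finite_subset)
    then obtain x where "?S - T = {x}" by (auto simp: card_1_singleton_iff)
    then have "T = ?S - {x}" "x \<in> ?S" using T by auto
    then have "T = {a, b, c} \<or> T = {a, b, d} \<or> T = {a, c, d} \<or> T = {b, c, d}"
      using dist by auto
    then show ?thesis using E by auto
  qed
  moreover have "?S \<subseteq> V"
    using E uniform by (auto simp: three_uniform_hypergraph_def)
  ultimately show False using K4_free by (auto simp: induces_four_hyperedges_def)
qed

lemma disjoint_pairs_line_neq:
  assumes "distinct [a, b, c, d]"
  shows "line E a b \<noteq> line E c d"
proof
  assume eq: "line E a b = line E c d"
  have "c \<in> line E a b" "d \<in> line E a b" "a \<in> line E c d" "b \<in> line E c d"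
    using line_endpoints eq by metis+
  then have "{a, b, c} \<in> E" "{a, b, d} \<in> E" "{c, d, a} \<in> E" "{c, d, b} \<in> E"
    using assms by (auto simp: in_line_iff)
  then show False
    using no_four_triples[OF assms] by (auto simp: insert_commute)
qed

text \<open>Used for injectivity of \<open>f\<close> inside one group, whose representative is
  \<open>c\<close>. Equality would put \<open>w\<close> on \<open>line E c v\<close>; the common
  line through \<open>u\<close> supplies the other three triples of a forbidden quadruple.\<close>

lemma no_line_with_four_common:
  assumes "distinct [u, c, v, w]" "line E u c = line E u v" "line E u c = line E u w"
  shows "line E c v \<noteq> line E c w"
proof
  assume "line E c v = line E c w"
  then have "w \<in> line E c v" "w \<in> line E u v" "w \<in> line E u c" "v \<in> line E u c"
    using line_endpoints assms(2,3) by metis+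
  then have "{c, v, w} \<in> E" "{u, v, w} \<in> E" "{u, c, w} \<in> E" "{u, c, v} \<in> E"
    using assms(1) by (auto simp: in_line_iff)
  then show False using no_four_triples[of u c v w] assms(1) by blast
qed

text \<open>A fourth vertex on the common line would form a hyperedge with each pair from
  \<open>u\<close>, \<open>v\<close>, \<open>w\<close>, and these three already form one.\<close>

lemma line_of_triangle:
  assumes "distinct [u, v, w]" "line E u v = line E u w" "line E v w = line E u v"
  shows "line E u v = {u, v, w}"
proof (rule ccontr)
  assume "line E u v \<noteq> {u, v, w}"
  moreover have "{u, v, w} \<subseteq> line E u v" using line_endpoints assms(2) by (metis insert_subset empty_subsetI)
  ultimately obtain x where x: "x \<in> line E u v" "x \<notin> {u, v, w}" by blast
  have "w \<in> line E u v" using line_endpoints assms(2) by metis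
  then have "{u, v, w} \<in> E" "{u, v, x} \<in> E" "{u, w, x} \<in> E" "{v, w, x} \<in> E"
    using assms x in_line_iff[of x u v E] in_line_iff[of x u w E] in_line_iff[of x v w E]
      in_line_iff[of w u v E] by auto
  then show False using no_four_triples[of u v w x] assms(1) x(2) by auto
qed

section \<open>Counting lines through and lines missing a fixed vertex\<close>

lemma lineI: "x \<in> V \<Longrightarrow> y \<in> V \<Longrightarrow> x \<noteq> y \<Longrightarrow> line E x y \<in> lines V E"
  by (auto simp: lines_def)

lemma finite_lines: "finite (lines V E)"
proof -
  have "lines V E \<subseteq> (\<lambda>(u, v). line E u v) ` (V \<times> V)"
    by (auto simp: lines_def)
  then show ?thesis using finite_V finite_subset by blast
qed

lemma card_lines_ge:
  assumes card: "card V \<ge> 2" and no_universal: "V \<notin> lines V E"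
  shows "card V \<le> card (lines V E)"
proof -
  have no_universal': "\<exists>w\<in>V. w \<notin> line E x y" if "x \<in> V" "y \<in> V" "x \<noteq> y" for x y
  proof -
    have "line E x y \<subseteq> V"
      using that uniform by (auto simp: line_def three_uniform_hypergraph_def)
    then show ?thesis using lineI[OF that] no_universal by (metis subsetI subset_antisym)
  qed
  obtain u where u: "u \<in> V" using card by fastforce
  \<comment> \<open>The choice depends on \<open>v\<close> only through \<open>line E u v\<close>,
    so a whole group gets the same representative.\<close>
  define r where "r v = (SOME w. w \<in> V - {u} \<and> line E u w = line E u v)" for v
  have r: "r v \<in> V" "r v \<noteq> u" "line E u (r v) = line E u v" if "v \<in> V - {u}" for v
  proof -
    have "r v \<in> V - {u} \<and> line E u (r v) = line E u v"
      unfolding r_def by (rule someI[of _ v]) (use that in auto)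
    then show "r v \<in> V" "r v \<noteq> u" "line E u (r v) = line E u v" by auto
  qed
  have r_cong: "r v = r w" if "line E u v = line E u w" for v w
    using that by (simp add: r_def)
  have r_idem: "r (r v) = r v" if "v \<in> V - {u}" for v
    using r(3)[OF that] by (rule r_cong)
  \<comment> \<open>As \<open>r v\<close> is its own representative, the second condition says
    \<open>f v = f (r v)\<close>: these are the collisions to be discarded.\<close>
  define S where "S = {v \<in> V - {u}. r v \<noteq> v \<and> line E (r v) v = line E u v}"
  define f where "f v = (if r v = v then line E u v else line E (r v) v)" for v
  have S_fin: "finite S" using finite_V by (simp add: S_def)

  have "inj_on f (V - {u} - S)"
  proof (rule inj_onI, rule ccontr)
    \<comment> \<open>If \<open>v\<close> is the representative of \<open>w\<close>, a collision
      would put \<open>w\<close> into \<open>S\<close>; otherwise \<open>{u, v}\<close> and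
      \<open>{r w, w}\<close> are disjoint pairs.\<close>
    have rep_nonrep: False
      if v: "v \<in> V - {u} - S" and w: "w \<in> V - {u} - S"
        and rv: "r v = v" and rw: "r w \<noteq> w" and eq: "f v = f w" for v w
    proof (cases "v = r w")
      case True
      then show False
        using r(3)[of w] v w rv rw eq by (auto simp: f_def S_def)
    next
      case False
      then have "distinct [u, v, r w, w]" using v w r[of w] rv rw by auto
      then show False using disjoint_pairs_line_neq eq rv rw by (simp add: f_def)
    qed
    fix v w
    assume v: "v \<in> V - {u} - S" and w: "w \<in> V - {u} - S"
      and eq: "f v = f w" and neq: "v \<noteq> w"
    consider "r v = v" "r w = w" | "r v = v" "r w \<noteq> w" | "r v \<noteq> v" "r w = w"
      | "r v \<noteq> v" "r w \<noteq> w" "r v = r w" | "r v \<noteq> v" "r w \<noteq> w" "r v \<noteq> r w"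
      by blast
    then show False
    proof cases
      case 1
      then show False using eq neq r_cong[of v w] by (simp add: f_def)
    next
      case 2
      then show False using rep_nonrep v w eq by blast
    next
      case 3
      then show False using rep_nonrep v w eq by metis
    next
      case 4
      then have "distinct [u, r v, v, w]" using v w r[of v] neq by auto
      moreover have "line E u (r v) = line E u v" "line E u (r v) = line E u w"
        using r(3)[of v] r(3)[of w] v w 4 by auto
      ultimately show False
        using no_line_with_four_common[of u "r v" v w] eq 4 by (simp add: f_def)
    next
      case 5
      \<comment> \<open>Representatives are fixed by \<open>r\<close>, whereas \<open>v\<close> and
        \<open>w\<close> are not, so neither can represent the other.\<close>
      then have "distinct [r v, v, r w, w]"
        using r_idem[of v] r_idem[of w] v w neq by auto
      then show False using disjoint_pairs_line_neq eq 5 by (simp add: f_def)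
    qed
  qed
  then have "card (f ` (V - {u} - S)) = card (V - {u} - S)" by (rule card_image)
  also have "\<dots> = card V - 1 - card S"
    using u S_fin by (subst card_Diff_subset) (auto simp: S_def)
  finally have card_f: "card (f ` (V - {u} - S)) = card V - 1 - card S" .

  have f_lines: "f v \<in> lines V E \<and> u \<in> f v" if "v \<in> V - {u}" for v
  proof (cases "r v = v")
    case True
    then show ?thesis using that u line_endpoints lineI by (auto simp: f_def)
  next
    case False
    have "v \<in> line E u (r v)" using r(3)[OF that] line_endpoints by metis
    then have "{u, r v, v} \<in> E" using that False by (auto simp: in_line_iff)
    then have "u \<in> line E (r v) v" by (simp add: line_def insert_commute)
    then show ?thesis using that False r[OF that] lineI by (auto simp: f_def)
  qed

  have tri: "line E u v = {u, v, r v}" "line E u (r v) = {u, v, r v}" "line E v (r v) = {u, v, r v}"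
    and S_mem: "v \<in> V" "r v \<in> V" "v \<noteq> u" "r v \<noteq> u" "r v \<noteq> v" if "v \<in> S" for v
  proof -
    show *: "v \<in> V" "r v \<in> V" "v \<noteq> u" "r v \<noteq> u" "r v \<noteq> v"
      using that r[of v] by (auto simp: S_def)
    have eq: "line E u v = line E u (r v)" "line E v (r v) = line E u v"
      using that r(3)[of v] line_commute[of E v] by (auto simp: S_def)
    show "line E u v = {u, v, r v}" by (rule line_of_triangle) (use * eq in auto)
    then show "line E u (r v) = {u, v, r v}" "line E v (r v) = {u, v, r v}" using eq by auto
  qed
  have groups: "distinct [v, r v, w, r w]" if "v \<in> S" "w \<in> S" "v \<noteq> w" for v w
  proof -
    note v = S_mem[OF that(1)] and w = S_mem[OF that(2)]
    have rv_w: "r v \<noteq> w" and rw_v: "r w \<noteq> v"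
      using r_idem[of v] r_idem[of w] v w by (metis DiffI singletonD)+
    \<comment> \<open>A shared representative would give both triples of \<open>tri\<close> the same
      line through \<open>u\<close>, leaving no room for \<open>w\<close>.\<close>
    have "r v \<noteq> r w"
    proof
      assume "r v = r w"
      then have "w \<in> {u, v, r v}" using tri(2)[OF that(1)] tri(2)[OF that(2)] by (metis insertI1 insertI2)
      then show False using w(3) rv_w that(3) by blast
    qed
    then show ?thesis using rv_w rw_v v(5) w(5) that(3) by simp
  qed

  have through_group_misses: "u \<notin> line E x y"
    if "v \<in> S" "x \<in> {v, r v}" "y \<notin> {u, v, r v}" for v x y
  proof -
    have "y \<notin> line E u x" using tri(1,2)[OF that(1)] that by auto
    then show ?thesis
      using not_in_line_rotate[of y E u x] S_mem[OF that(1)] that by auto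
  qed
  \<comment> \<open>Equality would make \<open>v\<close>, \<open>r v\<close>, \<open>x\<close> a
    hyperedge, but the line through \<open>v\<close> and \<open>r v\<close> has no vertex outside
    \<open>{u, v, r v}\<close>.\<close>
  have through_group_neq: "line E v x \<noteq> line E (r v) x"
    if "v \<in> S" "x \<notin> {u, v, r v}" for v x
  proof
    assume "line E v x = line E (r v) x"
    then have "r v \<in> line E v x" using line_endpoints by metis
    then have "{v, x, r v} \<in> E" using that S_mem[OF that(1)] by (auto simp: in_line_iff)
    then have "x \<in> line E v (r v)" by (simp add: line_def insert_commute)
    then show False using tri(3) that by auto
  qed

  define M where "M = {l \<in> lines V E. u \<notin> l}"
  have M_fin: "finite M" using finite_lines by (simp add: M_def)
  have groups_in_M: "line E x y \<in> M"
    if "v \<in> S" "w \<in> S" "v \<noteq> w" "x \<in> {v, r v}" "y \<in> {w, r w}" for v w x y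
  proof -
    have "x \<in> V" "y \<in> V" "y \<notin> {u, v, r v}" "x \<noteq> y"
      using that S_mem[OF that(1)] S_mem[OF that(2)] groups[OF that(1-3)] by auto
    then show ?thesis
      using through_group_misses[OF that(1,4)] lineI by (auto simp: M_def)
  qed
  \<comment> \<open>Lines in \<open>M\<close> miss \<open>u\<close> while every \<open>f v\<close>
    contains it, so the counts add up; \<open>card S + 1\<close> is what brings the total to
    \<open>card V\<close>.\<close>
  have card_M: "card S + 1 \<le> card M"
  proof -
    consider "card S = 0" | "card S = 1" | "card S \<ge> 2" by linarith
    then show ?thesis
    proof cases
      case 1
      have "card (V - {u}) \<ge> 1" using card u by simp
      then obtain v where v: "v \<in> V" "v \<noteq> u"
        by (metis Diff_iff card.empty ex_in_conv insertI1 not_one_le_zero)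
      obtain w where w: "w \<in> V" "w \<notin> line E u v" using no_universal' u v by metis
      then have "v \<noteq> w" using line_endpoints by metis
      then have "line E v w \<in> M"
        using not_in_line_rotate[OF w(2)] v w lineI by (auto simp: M_def)
      then have "M \<noteq> {}" by blast
      then have "card M > 0" using M_fin card_gt_0_iff by blast
      then show ?thesis using 1 by simp
    next
      case 2
      then obtain v where "S = {v}" by (auto simp: card_1_singleton_iff)
      then have v: "v \<in> S" by simp
      obtain x where x: "x \<in> V" "x \<notin> {u, v, r v}"
        using no_universal'[of u v] u S_mem[OF v] tri(1)[OF v] by auto
      have "{line E v x, line E (r v) x} \<subseteq> M"
        using through_group_misses[OF v _ x(2)] lineI x S_mem[OF v] by (auto simp: M_def)
      then have "card {line E v x, line E (r v) x} \<le> card M"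
        by (rule card_mono[OF M_fin])
      then show ?thesis using through_group_neq[OF v x(2)] 2 by simp
    next
      case 3
      define t where "t = card S"
      obtain h where h: "bij_betw h {0..<t} S"
        using ex_bij_betw_nat_finite[OF S_fin] t_def by blast
      have hS: "h i \<in> S" if "i < t" for i
        using h that by (auto simp: bij_betw_def)
      have hneq: "h i \<noteq> h j" if "i < t" "j < t" "i \<noteq> j" for i j
        using h that by (auto simp: bij_betw_def inj_on_def)
      have hd: "distinct [h i, r (h i), h j, r (h j)]" if "i < t" "j < t" "i \<noteq> j" for i j
        using groups hS hneq that by blast
      have r_neq: "r w \<noteq> v" if "v \<in> S" "w \<in> S" for v w
        using groups[OF that] S_mem(5)[OF that(1)] by (cases "v = w") auto
      have t: "t \<ge> 2" using 3 t_def by simp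
      define a where "a = h 0"
      define b where "b = h 1"
      have ab: "a \<in> S" "b \<in> S" "a \<noteq> b" using hS hneq t by (auto simp: a_def b_def)
      have dab: "distinct [a, r a, b, r b]" by (rule groups[OF ab])
      \<comment> \<open>Joining an element of \<open>S\<close> to the representative of the next one
        keeps the pairs for different \<open>j\<close> disjoint, since no element of
        \<open>S\<close> represents an element of \<open>S\<close>.\<close>
      define g where "g j = line E (h j) (r (h (Suc j)))" for j
      \<comment> \<open>Starting at 2 avoids the groups of \<open>a\<close> and \<open>b\<close>;
        stopping before \<open>t - 1\<close> keeps \<open>Suc j\<close> below \<open>t\<close>. The
        \<open>t - 3\<close> lines from \<open>g\<close> and the four in \<open>A\<close> give at
        least \<open>t + 1\<close>, also for \<open>t = 2\<close>, where the subtraction truncates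
        to 0.\<close>
      define J where "J = {2..<t - 1}"
      define A where "A = {line E a b, line E a (r b), line E (r a) b, line E (r a) (r b)}"
      have A_sub: "A \<subseteq> M" unfolding A_def using groups_in_M[OF ab] by auto
      have g_sub: "g ` J \<subseteq> M"
      proof -
        have "g j \<in> M" if "j \<in> J" for j
          unfolding g_def using groups_in_M[of "h j" "h (Suc j)"] hS hneq that
          by (auto simp: J_def)
        then show ?thesis by blast
      qed
      have g_inj: "inj_on g J"
      proof (rule inj_onI, rule ccontr)
        fix i j assume ij: "i \<in> J" "j \<in> J" "g i = g j" "i \<noteq> j"
        then have "i < t" "j < t" "Suc i < t" "Suc j < t" by (auto simp: J_def)
        then have "distinct [h i, r (h (Suc i)), h j, r (h (Suc j))]"
          using r_neq[OF hS hS] hneq[of i j] hd[of "Suc i" "Suc j"] ij(4) by (simp add: eq_commute)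
        then show False using disjoint_pairs_line_neq ij by (simp add: g_def)
      qed
      have "A \<inter> g ` J = {}"
      proof -
        have "line E x y \<noteq> g j" if "j \<in> J" "x \<in> {a, r a}" "y \<in> {b, r b}" for x y j
        proof -
          have "0 < t" "1 < t" "j < t" "Suc j < t" "0 \<noteq> j" "1 \<noteq> j" "0 \<noteq> Suc j" "1 \<noteq> Suc j"
            using that(1) by (auto simp: J_def)
          then have "distinct [a, r a, h j, r (h j)]" "distinct [b, r b, h j, r (h j)]"
            "distinct [a, r a, h (Suc j), r (h (Suc j))]" "distinct [b, r b, h (Suc j), r (h (Suc j))]"
            "h j \<noteq> r (h (Suc j))"
            using hd[of 0 j] hd[of 1 j] hd[of 0 "Suc j"] hd[of 1 "Suc j"] r_neq[OF hS hS]
            unfolding a_def b_def by metis+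
          then have "distinct [x, y, h j, r (h (Suc j))]"
            using that(2,3) dab by auto
          then show ?thesis unfolding g_def by (rule disjoint_pairs_line_neq)
        qed
        then show ?thesis by (auto simp: A_def)
      qed
      \<comment> \<open>Two of these lines given by pairs with a common endpoint differ by
        \<open>through_group_neq\<close>; the two cases of opposite pairs are disjoint
        pairs.\<close>
      moreover have "card A = 4"
      proof -
        have "a \<notin> {u, b, r b}" "r a \<notin> {u, b, r b}" "b \<notin> {u, a, r a}" "r b \<notin> {u, a, r a}"
          using dab S_mem[OF ab(1)] S_mem[OF ab(2)] by auto
        note n = through_group_neq[OF ab(1) this(3)] through_group_neq[OF ab(1) this(4)]
          through_group_neq[OF ab(2) this(1)] through_group_neq[OF ab(2) this(2)]
        have "line E a b \<noteq> line E (r a) (r b)" "line E a (r b) \<noteq> line E (r a) b"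
          using disjoint_pairs_line_neq[of a b "r a" "r b"]
            disjoint_pairs_line_neq[of a "r b" "r a" b] dab by auto
        then show ?thesis
          unfolding A_def using n by (simp add: line_commute[of E b] line_commute[of E "r b"])
      qed
      moreover have "card (g ` J) = t - 3"
        using card_image[OF g_inj] by (simp add: J_def)
      moreover have "finite A" "finite (g ` J)" by (auto simp: A_def J_def)
      ultimately have "card (A \<union> g ` J) = 4 + (t - 3)"
        by (simp add: card_Un_disjoint)
      moreover have "card (A \<union> g ` J) \<le> card M"
        using A_sub g_sub by (intro card_mono[OF M_fin]) auto
      ultimately show ?thesis using t_def by simp
    qed
  qed

  have "f ` (V - {u} - S) \<inter> M = {}" using f_lines by (auto simp: M_def)
  then have "card (f ` (V - {u} - S) \<union> M) = card (f ` (V - {u} - S)) + card M"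
    using finite_V M_fin by (intro card_Un_disjoint) auto
  moreover have "card (f ` (V - {u} - S) \<union> M) \<le> card (lines V E)"
    using f_lines by (intro card_mono[OF finite_lines]) (auto simp: M_def)
  ultimately show ?thesis using card_f card_M by linarith
qed

end

theorem theorem6:
  fixes V :: "'a set" and E :: "'a set set"
  assumes "finite V"
    and "three_uniform_hypergraph V E"
    and "card V \<ge> 2"
    and "\<not> (\<exists>S. S \<subseteq> V \<and> induces_four_hyperedges E S)"
  shows "de_bruijn_erdos V E"
proof -
  interpret K4_free_hypergraph V E
    using assms by unfold_locales
  show ?thesis using card_lines_ge assms(3) by (auto simp: de_bruijn_erdos_def)
qed

end
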